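(* Let $\hat{H}=\sum_\ell p_\ell P_\ell$ be a Hermitian operator specified as a convex combination of Pauli operators (finitely many $n$-qubit Pauli operators $P_\ell$, with $p_\ell>0$ and $\sum_\ell p_\ell=1$). For any $t\in\mathbb{R}$ and any $r\in\mathbb{N}=\{1,2,\dots\}$ there exists a linear decomposition $$e^{i\hat{H}t}=\sum_{k\in S_2}b_kU_k$$ for some (countable) index set $S_2$, real numbers $b_k>0$ and unitaries $U_k$, such that $$\sum_{k\in S_2}b_k\le\exp(t^2/r),$$ and such that for all $k\in S_2$ the non-Clifford cost of controlled-$U_k$ is that of $r$ controlled single-qubit Pauli rotations, i.e. the gate controlled-$U_k=|0\rangle\langle0|\otimes 1+|1\rangle\langle1|\otimes U_k$ can be implemented by a circuit consisting of Clifford gates and $r$ controlled single-qubit Pauli rotations.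
   Context: An $n$-qubit Pauli operator is (up to a sign $\pm1$) a tensor product of $n$ matrices from $\{1,X,Y,Z\}$. A single-qubit Pauli rotation is a gate $e^{i\theta P}$ with $\theta\in\mathbb{R}$ and $P\in\{1,X,Y,Z\}$ (for $P=1$ its controlled version is a phase gate on the control qubit); a controlled single-qubit Pauli rotation is $|0\rangle\langle0|\otimes1+|1\rangle\langle1|\otimes e^{i\theta P}$. The index set $S_2$ may be infinite, in which case the sum $\sum_k b_kU_k$ converges absolutely in operator norm. *)

theory Defs
  imports "HOL-Analysis.Analysis"
begin

text \<open>
  A register is a finite type \<open>'q\<close> of qubits. Its computational basis states are the bit strings
  \<open>'q \<Rightarrow> bool\<close> (\<open>False\<close> for 0, \<open>True\<close> for 1), so its state space is \<open>complex ^ ('q \<Rightarrow> bool)\<close>, of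
  dimension \<open>2 ^ CARD('q)\<close>. Matrix entries are \<open>A $ row $ column\<close>.
\<close>

type_synonym gate1 = "complex ^ bool ^ bool"
type_synonym 'q qop = "complex ^ ('q \<Rightarrow> bool) ^ ('q \<Rightarrow> bool)"

definition cscale :: "complex \<Rightarrow> complex ^ 'a ^ 'a \<Rightarrow> complex ^ 'a ^ 'a"
  where "cscale c A = (\<chi> i j. c * A $ i $ j)"

definition adj :: "complex ^ 'a ^ 'a \<Rightarrow> complex ^ 'a ^ 'a"
  where "adj A = (\<chi> i j. cnj (A $ j $ i))"

definition hermitian :: "complex ^ 'a ^ 'a \<Rightarrow> bool"
  where "hermitian A \<longleftrightarrow> adj A = A"

definition unitary :: "complex ^ 'a::finite ^ 'a \<Rightarrow> bool"
  where "unitary U \<longleftrightarrow> U ** adj U = mat 1 \<and> adj U ** U = mat 1"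

definition mpow :: "complex ^ 'a::finite ^ 'a \<Rightarrow> nat \<Rightarrow> complex ^ 'a ^ 'a"
  where "mpow A k = (((**) A) ^^ k) (mat 1)"

text \<open>
  Matrices have no Banach algebra instance in the library, so the library's \<open>exp\<close> does not apply
  to them.
\<close>

definition mexp :: "complex ^ 'a::finite ^ 'a \<Rightarrow> complex ^ 'a ^ 'a"
  where "mexp A = (\<Sum>k. mpow A k /\<^sub>R fact k)"

definition op_norm :: "complex ^ 'a::finite ^ 'a \<Rightarrow> real"
  where "op_norm A = onorm (\<lambda>v. A *v v)"

definition tensor :: "('q::finite \<Rightarrow> gate1) \<Rightarrow> 'q qop"
  where "tensor A = (\<chi> x y. \<Prod>q\<in>UNIV. A q $ x q $ y q)"

definition pauli_X :: gate1
  where "pauli_X = (\<chi> a b. if a = b then 0 else 1)"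

definition pauli_Y :: gate1
  where "pauli_Y = (\<chi> a b. if a = b then 0 else if a then \<i> else - \<i>)"

definition pauli_Z :: gate1
  where "pauli_Z = (\<chi> a b. if a = b then (if a then -1 else 1) else 0)"

definition pauli1 :: "gate1 set"
  where "pauli1 = {mat 1, pauli_X, pauli_Y, pauli_Z}"

definition pauli_ops :: "'q::finite qop set"
  where "pauli_ops = {s *\<^sub>R tensor A | s A. s \<in> {1, -1} \<and> (\<forall>q. A q \<in> pauli1)}"

text \<open>
  The Clifford group is the normalizer of the Pauli group in the unitary group. A unitary
  conjugate of a Hermitian operator is Hermitian, so it is enough to consider the Pauli operators
  with sign 1 or -1. As usual the Clifford group contains the global phases; a gate acting on some
  of the qubits only is included, tensored with the identity.
\<close>

definition clifford :: "'q::finite qop \<Rightarrow> bool"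
  where "clifford C \<longleftrightarrow> unitary C \<and> (\<lambda>P. C ** P ** adj C) ` pauli_ops = pauli_ops"

definition proj0 :: gate1
  where "proj0 = (\<chi> a b. if \<not> a \<and> \<not> b then 1 else 0)"

definition proj1 :: gate1
  where "proj1 = (\<chi> a b. if a \<and> b then 1 else 0)"

text \<open>Control qubit \<open>c\<close>, target qubit \<open>t\<close>, identity on the remaining qubits.\<close>

definition controlled1 :: "'q::finite \<Rightarrow> 'q \<Rightarrow> gate1 \<Rightarrow> 'q qop"
  where "controlled1 c t V =
    tensor ((\<lambda>_. mat 1)(c := proj0)) + tensor ((\<lambda>_. mat 1)(c := proj1, t := V))"

text \<open>
  The register \<open>'q option\<close> consists of the control qubit \<open>None\<close> and the qubits \<open>Some q\<close> of \<open>'q\<close>.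
\<close>

definition otimes :: "gate1 \<Rightarrow> 'q::finite qop \<Rightarrow> 'q option qop"
  where "otimes A B = (\<chi> x y. A $ x None $ y None * B $ (x \<circ> Some) $ (y \<circ> Some))"

definition controlled :: "'q::finite qop \<Rightarrow> 'q option qop"
  where "controlled U = otimes proj0 (mat 1) + otimes proj1 U"

text \<open>
  \<open>circuit r W\<close>: the operator \<open>W\<close> is implemented exactly by a circuit consisting of Clifford gates
  and \<open>r\<close> controlled single-qubit Pauli rotations, without ancilla qubits.
\<close>

inductive circuit :: "nat \<Rightarrow> 'q::finite qop \<Rightarrow> bool" where
  empty: "circuit 0 (mat 1)"
| clifford: "circuit r W \<Longrightarrow> clifford C \<Longrightarrow> circuit r (C ** W)"
| rotation: "circuit r W \<Longrightarrow> c \<noteq> t \<Longrightarrow> P \<in> pauli1 \<Longrightarrow>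
    circuit (Suc r) (controlled1 c t (mexp (cscale (\<i> * of_real \<theta>) P)) ** W)"

end

theory Submission
  imports Defs
begin

text \<open>
  Put \<open>x = t / r\<close> and \<open>J = \<i>H\<close>. Pairing each even term of the Taylor series of \<open>exp (x J)\<close> with the next
  odd one gives \<open>(x ^ (2m) / (2m)!) J ^ (2m) (1 + (x / (2m + 1)) J)\<close>. Expanding in the \<open>P\<^sub>l\<close>, the power
  \<open>J ^ (2m)\<close> becomes a convex combination of products of signed Pauli operators, which cost nothing
  when controlled, and \<open>1 + \<i>yP\<close> is \<open>sqrt (1 + y\<^sup>2)\<close> times a single rotation \<open>exp (\<i>\<theta>P)\<close> with
  \<open>\<theta> = arctan y\<close>. So \<open>exp (x J)\<close> has a decomposition with one rotation per term, of total weight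
  \<open>\<Sum>m. x ^ (2m) / (2m)! * sqrt (1 + (x / (2m + 1))\<^sup>2) \<le> exp (x\<^sup>2)\<close>, and its \<open>r\<close>-th power has total weight
  at most \<open>exp (r x\<^sup>2) = exp (t\<^sup>2 / r)\<close>.

  For the circuits: if the Pauli operators \<open>P\<close> and \<open>Q\<close> anticommute, \<open>(P + Q) / sqrt 2\<close> is a Clifford
  involution that swaps them by conjugation. Choosing \<open>Q\<close> supported on a single qubit reduces the
  rotation about \<open>P\<close> to a single-qubit one without any explicit Clifford circuit.
\<close>

subsection \<open>Matrices and Pauli operators\<close>

text \<open>Bilinearity is enough in finite dimension. Boundedness is what later carries infinite
  sums through a matrix product.\<close>

lemma bounded_bilinear_matrix_mult:
  "bounded_bilinear ((**) :: complex^'n::finite^'m::finite \<Rightarrow> complex^'k::finite^'n \<Rightarrow> complex^'k^'m)"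
proof -
  have "bilinear ((**) :: complex^'n^'m \<Rightarrow> complex^'k^'n \<Rightarrow> complex^'k^'m)"
    unfolding bilinear_def linear_iff
    by (auto simp: vec_eq_iff matrix_matrix_mult_def algebra_simps sum.distrib scaleR_sum_right)
  then show ?thesis by (simp add: bilinear_conv_bounded_bilinear)
qed

text \<open>The order matters: later proofs select the additive rules 1-6 or the scalar rules 7 and
  8 alone.\<close>

lemmas matrix_bilinear =
  bounded_bilinear.add_left[OF bounded_bilinear_matrix_mult]
  bounded_bilinear.add_right[OF bounded_bilinear_matrix_mult]
  bounded_bilinear.diff_left[OF bounded_bilinear_matrix_mult]
  bounded_bilinear.diff_right[OF bounded_bilinear_matrix_mult]
  bounded_bilinear.minus_left[OF bounded_bilinear_matrix_mult]
  bounded_bilinear.minus_right[OF bounded_bilinear_matrix_mult]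
  bounded_bilinear.scaleR_left[OF bounded_bilinear_matrix_mult]
  bounded_bilinear.scaleR_right[OF bounded_bilinear_matrix_mult]

lemmas matrix_zero =
  bounded_bilinear.zero_left[OF bounded_bilinear_matrix_mult]
  bounded_bilinear.zero_right[OF bounded_bilinear_matrix_mult]

lemma cscale_mult_left: "cscale c A ** B = cscale c (A ** B)"
  and cscale_mult_right: "A ** cscale c B = cscale c (A ** B)"
  for A B :: "complex^'a::finite^'a"
  by (auto simp: cscale_def vec_eq_iff matrix_matrix_mult_def sum_distrib_left mult_ac intro!: sum.cong)

lemma cscale_cscale [simp]: "cscale c (cscale d A) = cscale (c * d) A"
  by (simp add: cscale_def vec_eq_iff)

lemma cscale_1 [simp]: "cscale 1 A = A"
  by (simp add: cscale_def vec_eq_iff)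

lemma cscale_add: "cscale c (A + B) = cscale c A + cscale c B"
  by (simp add: cscale_def vec_eq_iff algebra_simps)

lemma cscale_minus [simp]: "cscale c (- A) = - cscale c A"
  by (simp add: cscale_def vec_eq_iff)

lemma cscale_minus_left [simp]: "cscale (- c) A = - cscale c A"
  by (simp add: cscale_def vec_eq_iff)

lemma cscale_of_real: "cscale (of_real a) A = a *\<^sub>R A"
  by (simp add: cscale_def vec_eq_iff vector_scaleR_component, simp add: scaleR_conv_of_real)

lemma cscale_scaleR: "cscale c (a *\<^sub>R A) = a *\<^sub>R cscale c A"
  by (simp add: cscale_def vec_eq_iff)

lemma cscale_sum: "cscale c (\<Sum>i\<in>I. f i) = (\<Sum>i\<in>I. cscale c (f i))"
  by (induction I rule: infinite_finite_induct) (simp_all add: cscale_add, simp_all add: cscale_def vec_eq_iff)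

lemma adj_mult: "adj (A ** B) = adj B ** adj A"
  by (simp add: adj_def matrix_matrix_mult_def vec_eq_iff mult_ac)

lemma adj_simps [simp]:
  "adj (A + B) = adj A + adj B" "adj (A - B) = adj A - adj B" "adj (- A) = - adj A"
  "adj (a *\<^sub>R A) = a *\<^sub>R adj A" "adj (cscale c A) = cscale (cnj c) (adj A)"
  "adj (adj A) = A"
  by (simp_all add: adj_def cscale_def vec_eq_iff)

lemma adj_mat_1 [simp]: "adj (mat 1) = mat 1"
  by (simp add: adj_def mat_def vec_eq_iff)

lemma unitary_mult:
  assumes "unitary U" "unitary V"
  shows "unitary (U ** V)"
proof -
  have "U ** V ** (adj V ** adj U) = U ** (V ** adj V) ** adj U"
    by (simp add: matrix_mul_assoc)
  moreover have "adj V ** adj U ** (U ** V) = adj V ** (adj U ** U) ** V"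
    by (simp add: matrix_mul_assoc)
  ultimately show ?thesis
    using assms by (simp add: unitary_def adj_mult)
qed

text \<open>Distributivity: a product over qubits of sums over one bit expands into a sum over all
  bit strings.\<close>

lemma tensor_mult: "tensor A ** tensor B = tensor (\<lambda>q. A q ** B q)"
proof -
  have "(\<Sum>z\<in>UNIV. (\<Prod>q\<in>UNIV. A q $ x q $ z q) * (\<Prod>q\<in>UNIV. B q $ z q $ y q)) =
        (\<Prod>q\<in>UNIV. \<Sum>b\<in>UNIV. A q $ x q $ b * B q $ b $ y q)" for x y :: "'a \<Rightarrow> bool"
    by (subst prod_sum_PiE) (simp_all add: prod.distrib)
  then show ?thesis
    by (simp add: tensor_def matrix_matrix_mult_def vec_eq_iff)
qed

lemma tensor_cscale: "tensor (\<lambda>q. cscale (c q) (A q)) = cscale (\<Prod>q\<in>UNIV. c q) (tensor A)"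
  by (simp add: tensor_def cscale_def vec_eq_iff prod.distrib)

lemma tensor_mat_1 [simp]: "tensor (\<lambda>_. mat 1) = mat 1"
proof -
  have "(\<Prod>q\<in>UNIV. if x q = y q then 1 else 0 :: complex) = (if x = y then 1 else 0)"
    for x y :: "'a \<Rightarrow> bool"
    by (cases "x = y") (auto simp: fun_eq_iff)
  then show ?thesis
    by (simp add: tensor_def mat_def vec_eq_iff)
qed

lemma adj_tensor: "adj (tensor A) = tensor (\<lambda>q. adj (A q))"
  by (simp add: tensor_def adj_def vec_eq_iff)

section \<open>The Pauli group and a criterion for Clifford operators\<close>

definition phases :: "complex set"
  where "phases = {1, -1, \<i>, -\<i>}"

lemma phases_mult: "c \<in> phases \<Longrightarrow> d \<in> phases \<Longrightarrow> c * d \<in> phases"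
  by (auto simp: phases_def)

lemma phases_prod: "(\<And>i. i \<in> I \<Longrightarrow> c i \<in> phases) \<Longrightarrow> prod c I \<in> phases"
  by (induction I rule: infinite_finite_induct) (auto intro: phases_mult, auto simp: phases_def)

lemma pauli1_square:
  assumes "A \<in> pauli1"
  shows "A ** A = mat 1"
  using assms unfolding pauli1_def
  by (auto simp: matrix_matrix_mult_def vec_eq_iff pauli_X_def pauli_Y_def pauli_Z_def mat_def UNIV_bool)

lemma pauli_products:
  "pauli_X ** pauli_Y = cscale \<i> pauli_Z" "pauli_Y ** pauli_X = cscale (-\<i>) pauli_Z"
  "pauli_Y ** pauli_Z = cscale \<i> pauli_X" "pauli_Z ** pauli_Y = cscale (-\<i>) pauli_X"
  "pauli_Z ** pauli_X = cscale \<i> pauli_Y" "pauli_X ** pauli_Z = cscale (-\<i>) pauli_Y"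
  by (auto simp: matrix_matrix_mult_def vec_eq_iff pauli_X_def pauli_Y_def pauli_Z_def
      cscale_def UNIV_bool)

lemma pauli1_mult:
  assumes "A \<in> pauli1" "B \<in> pauli1"
  shows "\<exists>c\<in>phases. \<exists>D\<in>pauli1. A ** B = cscale c D"
proof (cases "A = mat 1 \<or> B = mat 1 \<or> A = B")
  case True
  then have "A ** B = cscale 1 A \<or> A ** B = cscale 1 B \<or> A ** B = cscale 1 (mat 1)"
    using assms by (auto simp: pauli1_square)
  then show ?thesis
    using assms unfolding phases_def pauli1_def by blast
next
  case False
  then have "A \<in> {pauli_X, pauli_Y, pauli_Z}" "B \<in> {pauli_X, pauli_Y, pauli_Z}"
    using assms by (auto simp: pauli1_def)
  with False have "\<exists>D\<in>{pauli_X, pauli_Y, pauli_Z}. A ** B = cscale \<i> D \<or> A ** B = cscale (-\<i>) D"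
    using pauli_products by auto
  then show ?thesis
    unfolding phases_def pauli1_def by blast
qed

lemma adj_pauli1:
  assumes "A \<in> pauli1"
  shows "adj A = A"
  using assms unfolding pauli1_def
  by (auto simp: adj_def vec_eq_iff pauli_X_def pauli_Y_def pauli_Z_def mat_def)

text \<open>Supplies the single-qubit partner needed to move a rotation onto one qubit.\<close>

lemma pauli1_anticommuting:
  assumes "A \<in> pauli1" "A \<noteq> mat 1"
  obtains B where "B \<in> pauli1" "A ** B = - (B ** A)"
proof -
  have "A ** B = - (B ** A) \<and> B \<in> pauli1"
    if "(A, B) \<in> {(pauli_X, pauli_Z), (pauli_Y, pauli_Z), (pauli_Z, pauli_X)}" for A B
    using that by (auto simp: pauli_products pauli1_def)
  moreover have "A \<in> {pauli_X, pauli_Y, pauli_Z}"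
    using assms by (auto simp: pauli1_def)
  ultimately show ?thesis
    using that by blast
qed

text \<open>Products leave \<open>pauli_ops\<close>, as in \<open>XY = \<i>Z\<close>; allowing all
  fourth roots of unity restores closure.\<close>

definition pauli_group :: "'q::finite qop set"
  where "pauli_group = {cscale c (tensor A) | c A. c \<in> phases \<and> (\<forall>q. A q \<in> pauli1)}"

lemma pauli_group_mult:
  assumes "P \<in> pauli_group" "Q \<in> pauli_group"
  shows "P ** Q \<in> pauli_group"
proof -
  obtain c A where P: "P = cscale c (tensor A)" "c \<in> phases" "\<And>q. A q \<in> pauli1"
    using assms by (auto simp: pauli_group_def)
  obtain d B where Q: "Q = cscale d (tensor B)" "d \<in> phases" "\<And>q. B q \<in> pauli1"
    using assms by (auto simp: pauli_group_def)
  have "\<forall>q. \<exists>e D. e \<in> phases \<and> D \<in> pauli1 \<and> A q ** B q = cscale e D"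
    using pauli1_mult P(3) Q(3) by blast
  then obtain e D where eD: "\<And>q. e q \<in> phases" "\<And>q. D q \<in> pauli1"
    "\<And>q. A q ** B q = cscale (e q) (D q)"
    by metis
  have "P ** Q = cscale (c * d * (\<Prod>q\<in>UNIV. e q)) (tensor D)"
    by (simp add: P(1) Q(1) cscale_mult_left cscale_mult_right tensor_mult eD(3) tensor_cscale mult_ac)
  then show ?thesis
    unfolding pauli_group_def using eD P(2) Q(2) by (blast intro: phases_mult phases_prod)
qed

lemma pauli_ops_subset: "P \<in> pauli_ops \<Longrightarrow> P \<in> pauli_group"
proof -
  assume "P \<in> pauli_ops"
  then obtain s A where "P = s *\<^sub>R tensor A" "s \<in> {1, -1}" "\<forall>q. A q \<in> pauli1"
    by (auto simp: pauli_ops_def)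
  then have "P = cscale (of_real s) (tensor A) \<and> of_real s \<in> phases \<and> (\<forall>q. A q \<in> pauli1)"
    by (auto simp: cscale_of_real phases_def cscale_def vec_eq_iff)
  then show ?thesis
    unfolding pauli_group_def by blast
qed

lemma pauli_ops_square: "P \<in> pauli_ops \<Longrightarrow> P ** P = mat 1"
  by (auto simp: pauli_ops_def matrix_bilinear tensor_mult pauli1_square)

lemma adj_pauli_ops: "P \<in> pauli_ops \<Longrightarrow> adj P = P"
  by (auto simp: pauli_ops_def adj_tensor adj_pauli1)

lemma pauli_ops_minus: "P \<in> pauli_ops \<Longrightarrow> - P \<in> pauli_ops"
proof -
  assume "P \<in> pauli_ops"
  then obtain s A where "P = s *\<^sub>R tensor A" "s \<in> {1, -1}" "\<forall>q. A q \<in> pauli1"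
    by (auto simp: pauli_ops_def)
  then have "- P = (- s) *\<^sub>R tensor A \<and> - s \<in> {1, -1} \<and> (\<forall>q. A q \<in> pauli1)"
    by auto
  then show ?thesis
    unfolding pauli_ops_def by blast
qed

lemma tensor_in_pauli_ops: "(\<And>q. A q \<in> pauli1) \<Longrightarrow> tensor A \<in> pauli_ops"
  unfolding pauli_ops_def by (auto intro!: exI[of _ 1])

lemma mat_1_in_pauli_ops: "mat 1 \<in> pauli_ops"
  using tensor_in_pauli_ops[of "\<lambda>_. mat 1"] by (simp add: pauli1_def)

lemma mat_1_neq_0: "mat 1 \<noteq> (0 :: complex^'a::finite^'a)"
  by (auto simp: mat_def vec_eq_iff)

text \<open>A tensor product of Pauli matrices is Hermitian and nonzero, so a Hermitian multiple of
  it has a real phase.\<close>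

lemma pauli_opsI:
  assumes "P \<in> pauli_group" "adj P = P"
  shows "P \<in> pauli_ops"
proof -
  obtain c A where P: "P = cscale c (tensor A)" "c \<in> phases" "\<And>q. A q \<in> pauli1"
    using assms by (auto simp: pauli_group_def)
  have T: "tensor A \<in> pauli_ops"
    using P(3) by (rule tensor_in_pauli_ops)
  have "cscale (cnj c) (tensor A) = cscale c (tensor A)"
    using assms(2) adj_pauli_ops[OF T] by (simp add: P(1))
  moreover have "tensor A \<noteq> 0"
    using pauli_ops_square[OF T] mat_1_neq_0 by (metis matrix_zero(1))
  ultimately have "c = cnj c"
    by (auto simp: cscale_def vec_eq_iff)
  then have "c \<in> {1, -1}"
    using P(2) by (auto simp: phases_def complex_eq_iff)
  then show ?thesis
    using T pauli_ops_minus[OF T] by (auto simp: P(1))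
qed

text \<open>Taking adjoints of \<open>P ** Q = cscale c T\<close> with \<open>T\<close> Hermitian
  conjugates the phase, and the conjugate of a fourth root of unity \<open>c\<close> is
  \<open>c\<close> or \<open>-c\<close>.\<close>

lemma pauli_ops_commute_or_anticommute:
  assumes "P \<in> pauli_ops" "Q \<in> pauli_ops"
  shows "P ** Q = Q ** P \<or> P ** Q = - (Q ** P)"
proof -
  obtain c A where PQ: "P ** Q = cscale c (tensor A)" "c \<in> phases" "\<And>q. A q \<in> pauli1"
    using pauli_group_mult[OF assms[THEN pauli_ops_subset]] by (auto simp: pauli_group_def)
  have "Q ** P = cscale (cnj c) (tensor A)"
    using arg_cong[OF PQ(1), of adj] adj_pauli_ops[OF tensor_in_pauli_ops, of A] PQ(3)
    by (simp add: adj_mult adj_pauli_ops assms)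
  moreover have "cnj c = c \<or> cnj c = - c"
    using PQ(2) by (auto simp: phases_def)
  ultimately show ?thesis
    using PQ(1) by auto
qed

lemma unitary_pauli_ops: "P \<in> pauli_ops \<Longrightarrow> unitary P"
  by (simp add: unitary_def adj_pauli_ops pauli_ops_square)

text \<open>Conjugation by a Hermitian involution preserves Hermiticity, so landing in
  \<open>pauli_group\<close> means landing in \<open>pauli_ops\<close>; it is also its own inverse,
  which gives surjectivity.\<close>

lemma cliffordI:
  fixes C :: "'q::finite qop"
  assumes C: "C ** C = mat 1" "adj C = C"
    and conj: "\<And>R. R \<in> pauli_ops \<Longrightarrow> C ** R ** C \<in> pauli_group"
  shows "clifford C"
proof -
  have ops: "C ** R ** C \<in> pauli_ops" if "R \<in> pauli_ops" for R
    using conj[OF that] by (rule pauli_opsI) (simp add: adj_mult C adj_pauli_ops that matrix_mul_assoc)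
  have "R \<in> (\<lambda>P. C ** P ** C) ` pauli_ops" if "R \<in> pauli_ops" for R
  proof (rule image_eqI[OF _ ops[OF that]])
    have "C ** (C ** R ** C) ** C = (C ** C) ** R ** (C ** C)"
      by (simp only: matrix_mul_assoc)
    then show "R = C ** (C ** R ** C) ** C"
      by (simp add: C)
  qed
  then show ?thesis
    using ops by (auto simp: clifford_def unitary_def C)
qed

subsection \<open>Clifford operators from pairs of Pauli operators\<close>

text \<open>For \<open>P = X\<close> and \<open>Q = Z\<close> this is the Hadamard gate. If
  \<open>R\<close> commutes or anticommutes with both in the same way, conjugation gives
  \<open>R\<close> or \<open>-R\<close>; in the mixed cases it gives \<open>R ** P ** Q\<close> up
  to sign.\<close>

lemma clifford_anticommuting_pauli_ops:
  fixes P Q :: "'q::finite qop"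
  assumes PQ: "P \<in> pauli_ops" "Q \<in> pauli_ops" "Q ** P = - (P ** Q)"
  defines "C \<equiv> (1 / sqrt 2) *\<^sub>R (P + Q)"
  shows "clifford C" "C ** C = mat 1" "adj C = C" "C ** Q ** C = P"
proof -
  note sq = pauli_ops_square[OF PQ(1)] pauli_ops_square[OF PQ(2)]
  have G: "P \<in> pauli_group" "Q \<in> pauli_group"
    using PQ by (auto intro: pauli_ops_subset)
  \<comment> \<open>The two normalizing factors merge into \<open>1/2\<close>, so no square root
    remains in the computations.\<close>
  have *: "C ** X ** C = (1/2) *\<^sub>R ((P + Q) ** X ** (P + Q))" for X
    by (simp add: C_def matrix_bilinear(7,8))
  show CC: "C ** C = mat 1"
    using *[of "mat 1"] by (simp add: matrix_bilinear(1-6) sq PQ(3) scaleR_2[symmetric])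
  show adjC: "adj C = C"
    by (simp add: C_def adj_pauli_ops PQ)
  \<comment> \<open>The prefix \<open>X\<close> lets these rules act inside left-nested words; they
    cancel squares and sort \<open>P\<close> before \<open>Q\<close>.\<close>
  have assoc: "X ** P ** P = X" "X ** Q ** Q = X" "X ** Q ** P = - (X ** P ** Q)" for X
    by (simp_all add: matrix_mul_assoc[symmetric] sq PQ(3) matrix_bilinear)
  show "C ** Q ** C = P"
    by (simp add: * matrix_bilinear sq assoc scaleR_2[symmetric])
  show "clifford C"
  proof (rule cliffordI[OF CC adjC])
    fix R :: "'q qop" assume R: "R \<in> pauli_ops"
    then have RG: "R \<in> pauli_group" "R ** P ** Q \<in> pauli_group"
      using G by (auto intro: pauli_group_mult pauli_ops_subset)
    have RG': "- R \<in> pauli_group" "- (R ** P ** Q) \<in> pauli_group"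
      using G pauli_ops_minus[OF R] by (auto intro: pauli_group_mult pauli_ops_subset simp flip: matrix_bilinear(5))
    have "C ** R ** C = R \<or> C ** R ** C = - R \<or>
        C ** R ** C = R ** P ** Q \<or> C ** R ** C = - (R ** P ** Q)"
      using pauli_ops_commute_or_anticommute[OF PQ(1) R]
        pauli_ops_commute_or_anticommute[OF PQ(2) R]
      by (elim disjE) (simp_all add: * matrix_bilinear assoc scaleR_2[symmetric])
    then show "C ** R ** C \<in> pauli_group"
      using RG RG' by auto
  qed
qed

text \<open>The operator is \<open>(1 + A)/2 + ((1 - A)/2) B\<close>, that is, \<open>B\<close>
  controlled by the eigenvalue of \<open>A\<close>. It is stated for abstract commuting
  \<open>A\<close> and \<open>B\<close> so that only the sign pattern enters.\<close>

lemma clifford_commuting_pauli_ops: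
  fixes A B :: "'q::finite qop"
  assumes AB: "A \<in> pauli_ops" "B \<in> pauli_ops" "B ** A = A ** B"
  shows "clifford ((1/2) *\<^sub>R (mat 1 + A + B - A ** B))" (is "clifford ?C")
proof (rule cliffordI)
  note sq = pauli_ops_square[OF AB(1)] pauli_ops_square[OF AB(2)]
  have G: "A \<in> pauli_group" "B \<in> pauli_group"
    using AB by (auto intro: pauli_ops_subset)
  have assoc: "X ** A ** A = X" "X ** B ** B = X" "X ** B ** A = X ** A ** B" for X
    by (simp_all add: matrix_mul_assoc[symmetric] sq AB(3))
  have four: "4 *\<^sub>R X = X + X + X + X" for X :: "'q qop"
    using scaleR_add_left[of 2 2 X] by (simp add: scaleR_2)
  define M where "M = mat 1 + A + B - A ** B"
  note expand = M_def matrix_bilinear matrix_mul_assoc sq assoc AB(3) four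
  \<comment> \<open>The left factors are \<open>M\<close> with the signs of \<open>A\<close> and
    \<open>B\<close> flipped independently, the sign of \<open>A ** B\<close> following. Each
    product collapses to a single Pauli term.\<close>
  have table: "M ** M = 4 *\<^sub>R mat 1"
    "(mat 1 - A + B + A ** B) ** M = 4 *\<^sub>R B"
    "(mat 1 + A - B + A ** B) ** M = 4 *\<^sub>R A"
    "(mat 1 - A - B - A ** B) ** M = 4 *\<^sub>R (- (A ** B))"
    by (simp_all add: expand)
  show CC: "?C ** ?C = mat 1"
    using table(1) by (simp add: matrix_bilinear(7,8) flip: M_def)
  show "adj ?C = ?C"
    by (simp add: adj_mult adj_pauli_ops AB)
  fix R :: "'q qop" assume R: "R \<in> pauli_ops"
  then have RG: "R \<in> pauli_group"
    by (rule pauli_ops_subset)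
  obtain a b :: real where ab: "a \<in> {1, -1}" "b \<in> {1, -1}"
    and AR: "A ** R = a *\<^sub>R (R ** A)" and BR: "B ** R = b *\<^sub>R (R ** B)"
  proof -
    have "\<exists>a\<in>{1, -1::real}. A' ** R = a *\<^sub>R (R ** A')" if "A' \<in> pauli_ops" for A'
      using pauli_ops_commute_or_anticommute[OF that R] by auto
    then show ?thesis
      using that AB by blast
  qed
  have "A ** B ** R = A ** (B ** R)"
    by (simp add: matrix_mul_assoc)
  also have "\<dots> = b *\<^sub>R (A ** R ** B)"
    by (simp add: BR matrix_bilinear matrix_mul_assoc)
  also have "\<dots> = (a * b) *\<^sub>R (R ** (A ** B))"
    by (simp add: AR matrix_bilinear matrix_mul_assoc)
  \<comment> \<open>Moving \<open>R\<close> to the left through \<open>M\<close> only flips signs,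
    so \<open>M ** R ** M\<close> reduces to an entry of \<open>table\<close>.\<close>
  finally have "M ** R = R ** (mat 1 + a *\<^sub>R A + b *\<^sub>R B - (a * b) *\<^sub>R (A ** B))"
    by (simp add: M_def matrix_bilinear AR BR)
  then obtain N where N: "M ** R = R ** N"
    "N \<in> {M, mat 1 - A + B + A ** B, mat 1 + A - B + A ** B, mat 1 - A - B - A ** B}"
    using ab by (auto simp: M_def)
  have "\<exists>X\<in>{mat 1, A, B, - (A ** B)}. N ** M = 4 *\<^sub>R X"
    using N(2) table by (elim insertE emptyE) simp_all
  then obtain X where X: "N ** M = 4 *\<^sub>R X" "X \<in> {mat 1, A, B, - (A ** B)}"
    by blast
  have "M ** R ** M = R ** (N ** M)"
    by (simp add: N(1) matrix_mul_assoc)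
  also have "\<dots> = 4 *\<^sub>R (R ** X)"
    by (simp add: X(1) matrix_bilinear)
  finally have "M ** R ** M = 4 *\<^sub>R (R ** X)" .
  moreover have "?C ** R ** ?C = (1/4) *\<^sub>R (M ** R ** M)"
    by (simp add: M_def matrix_bilinear(7,8))
  ultimately have "?C ** R ** ?C \<in> {R, R ** A, R ** B, - R ** A ** B}"
    using X(2) by (auto simp: matrix_bilinear matrix_mul_assoc)
  moreover have "{R, R ** A, R ** B, - R ** A ** B} \<subseteq> pauli_group"
    using RG G pauli_ops_subset[OF pauli_ops_minus[OF R]] by (auto intro!: pauli_group_mult)
  ultimately show "?C ** R ** ?C \<in> pauli_group"
    by blast
qed

subsection \<open>Controlled operators and circuits\<close>

lemma bij_betw_option_fun:
  "bij_betw (\<lambda>x. (x None, x \<circ> Some)) (UNIV :: ('q option \<Rightarrow> 'b) set) UNIV"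
  by (rule bij_betw_byWitness[where f' = "\<lambda>(a, f). case_option a f"])
    (auto simp: fun_eq_iff split: option.split)

text \<open>The intermediate bit string splits into its control bit and the remaining bits, and the
  double sum factors.\<close>

lemma otimes_mult: "otimes A B ** otimes A' B' = otimes (A ** A') (B ** B')"
  for A A' :: gate1 and B B' :: "'q::finite qop"
proof -
  have "(\<Sum>z\<in>UNIV. (A $ a $ z None * B $ x $ (z \<circ> Some)) * (A' $ z None $ b * B' $ (z \<circ> Some) $ y))
      = (\<Sum>(c, z)\<in>UNIV. (A $ a $ c * A' $ c $ b) * (B $ x $ z * B' $ z $ y))" for a b x y
    by (subst sum.reindex_bij_betw[OF bij_betw_option_fun, symmetric]) (simp add: mult_ac)
  also have "\<dots> a b x y = (\<Sum>c\<in>UNIV. A $ a $ c * A' $ c $ b) * (\<Sum>z\<in>UNIV. B $ x $ z * B' $ z $ y)"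
    for a b x y
    by (simp add: sum_product sum.cartesian_product del: UNIV_bool flip: UNIV_Times_UNIV)
  finally show ?thesis
    by (simp add: otimes_def matrix_matrix_mult_def vec_eq_iff)
qed

lemma otimes_linear [simp]:
  "otimes (A + A') B = otimes A B + otimes A' B" "otimes (A - A') B = otimes A B - otimes A' B"
  "otimes (- A) B = - otimes A B" "otimes (a *\<^sub>R A) B = a *\<^sub>R otimes A B" "otimes 0 B = 0"
  "otimes A (B + B') = otimes A B + otimes A B'" "otimes A (- B) = - otimes A B"
  "otimes A (a *\<^sub>R B) = a *\<^sub>R otimes A B"
  by (simp_all add: otimes_def vec_eq_iff algebra_simps)

lemma otimes_tensor: "otimes A (tensor B) = tensor (case_option A B)"
  by (simp add: otimes_def tensor_def vec_eq_iff UNIV_option_conv prod.reindex)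

lemma otimes_mat_1 [simp]: "otimes (mat 1) (mat 1) = mat 1"
proof -
  have "case_option (mat 1) (\<lambda>_. mat 1) = (\<lambda>_::'a option. mat 1 :: gate1)"
    by (auto simp: fun_eq_iff split: option.split)
  then show ?thesis
    using otimes_tensor[of "mat 1" "\<lambda>_::'a. mat 1"] by simp
qed

lemma otimes_in_pauli_ops:
  assumes "A \<in> pauli1" "P \<in> pauli_ops"
  shows "otimes A P \<in> pauli_ops"
proof -
  obtain s B where P: "P = s *\<^sub>R tensor B" "s \<in> {1, -1}" "\<forall>q. B q \<in> pauli1"
    using assms by (auto simp: pauli_ops_def)
  have "otimes A P = s *\<^sub>R tensor (case_option A B)"
    by (simp add: P(1) otimes_tensor)
  moreover have "\<forall>q. case_option A B q \<in> pauli1"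
    using assms(1) P(3) by (auto split: option.split)
  ultimately show ?thesis
    using P(2) unfolding pauli_ops_def by blast
qed

lemma proj_simps:
  "proj0 ** proj0 = proj0" "proj1 ** proj1 = proj1" "proj0 ** proj1 = 0" "proj1 ** proj0 = 0"
  "proj0 = (1/2) *\<^sub>R (mat 1 + pauli_Z)" "proj1 = (1/2) *\<^sub>R (mat 1 - pauli_Z)"
proof -
  have "(1/2) *\<^sub>R (2 :: complex) = 1"
    by (simp add: scaleR_conv_of_real)
  then show "proj0 ** proj0 = proj0" "proj1 ** proj1 = proj1" "proj0 ** proj1 = 0" "proj1 ** proj0 = 0"
    "proj0 = (1/2) *\<^sub>R (mat 1 + pauli_Z)" "proj1 = (1/2) *\<^sub>R (mat 1 - pauli_Z)"
    by (auto simp: matrix_matrix_mult_def vec_eq_iff proj0_def proj1_def pauli_Z_def mat_def UNIV_bool)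
qed

lemma proj_sum: "proj0 + proj1 = mat 1"
  by (auto simp: vec_eq_iff proj0_def proj1_def mat_def)

text \<open>\<open>proj0\<close> and \<open>proj1\<close> are orthogonal idempotents, so the cross
  terms vanish.\<close>

lemma controlled_mult: "controlled U ** controlled V = controlled (U ** V)"
  by (simp add: controlled_def matrix_bilinear otimes_mult proj_simps(1-4))

lemma controlled_mat_1: "controlled (mat 1) = mat 1"
proof -
  have "controlled (mat 1) = otimes (proj0 + proj1) (mat 1)"
    by (simp only: controlled_def otimes_linear)
  then show ?thesis
    by (simp add: proj_sum)
qed

text \<open>The outer \<open>C\<close> may be applied without control: when the control is 0 the two
  copies cancel.\<close>

lemma controlled_conjugate:
  assumes "C ** C = mat 1"
  shows "controlled (C ** U ** C) = otimes (mat 1) C ** controlled U ** otimes (mat 1) C"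
  by (simp add: controlled_def matrix_bilinear otimes_mult assms)

text \<open>Writing the projections as \<open>(1 + Z)/2\<close> and \<open>(1 - Z)/2\<close> gives
  the commuting form with \<open>A = Z\<close> on the control. Hence Pauli factors cost no
  rotation.\<close>

lemma clifford_controlled_pauli:
  assumes "P \<in> pauli_ops"
  shows "clifford (controlled P)"
proof -
  define A where "A = otimes pauli_Z (mat 1 :: 'a qop)"
  define B where "B = otimes (mat 1) P"
  have "A \<in> pauli_ops" "B \<in> pauli_ops"
    by (simp_all add: A_def B_def otimes_in_pauli_ops mat_1_in_pauli_ops assms pauli1_def)
  moreover have "B ** A = A ** B"
    by (simp add: A_def B_def otimes_mult)
  ultimately have "clifford ((1/2) *\<^sub>R (mat 1 + A + B - A ** B))"
    by (rule clifford_commuting_pauli_ops)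
  moreover have "controlled P = (1/2) *\<^sub>R (mat 1 + A + B - A ** B)"
    by (simp add: controlled_def A_def B_def otimes_mult proj_simps(5,6) algebra_simps)
  ultimately show ?thesis
    by simp
qed

text \<open>Multilinearity in the factor at \<open>q\<close>, seen by splitting that factor off the
  entrywise product.\<close>

lemma tensor_upd_add: "tensor (A(q := X + Y)) = tensor (A(q := X)) + tensor (A(q := Y))"
  and tensor_upd_cscale: "tensor (A(q := cscale c X)) = cscale c (tensor (A(q := X)))"
  for A :: "'q::finite \<Rightarrow> gate1"
proof -
  have *: "(\<Prod>p\<in>UNIV. (A(q := Z)) p $ x p $ y p) = Z $ x q $ y q * (\<Prod>p\<in>UNIV - {q}. A p $ x p $ y p)"
    for Z and x y :: "'q \<Rightarrow> bool"
  proof -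
    have "(\<Prod>p\<in>UNIV. (A(q := Z)) p $ x p $ y p) =
        Z $ x q $ y q * (\<Prod>p\<in>UNIV - {q}. (A(q := Z)) p $ x p $ y p)"
      by (subst prod.remove[of UNIV q]) auto
    also have "(\<Prod>p\<in>UNIV - {q}. (A(q := Z)) p $ x p $ y p) = (\<Prod>p\<in>UNIV - {q}. A p $ x p $ y p)"
      by (rule prod.cong) auto
    finally show ?thesis .
  qed
  show "tensor (A(q := X + Y)) = tensor (A(q := X)) + tensor (A(q := Y))"
    and "tensor (A(q := cscale c X)) = cscale c (tensor (A(q := X)))"
    by (simp_all only: tensor_def vec_eq_iff vec_lambda_beta vector_add_component cscale_def *)
      (simp_all add: algebra_simps)
qed

lemma controlled1_None_Some: "controlled1 None (Some q) V = controlled (tensor ((\<lambda>_. mat 1)(q := V)))"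
proof -
  have "(\<lambda>_. mat 1)(None := proj0) = case_option proj0 (\<lambda>_::'a. mat 1)"
    "(\<lambda>_. mat 1)(None := proj1, Some q := V) = case_option proj1 ((\<lambda>_. mat 1)(q := V))"
    by (auto simp: fun_eq_iff split: option.split)
  then show ?thesis
    by (simp add: controlled1_def controlled_def flip: otimes_tensor)
qed

lemma circuit_append:
  assumes "circuit r V" "circuit s W"
  shows "circuit (r + s) (V ** W)"
  using assms(1)
proof induction
  case empty
  then show ?case using assms(2) by simp
next
  case (clifford r W' C)
  then show ?case using circuit.clifford by (metis matrix_mul_assoc)
next
  case (rotation r W' c t P \<theta>)
  then show ?case using circuit.rotation by (metis matrix_mul_assoc add_Suc)
qed

lemma circuit_clifford: "clifford C \<Longrightarrow> circuit 0 C"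
  using circuit.clifford[OF circuit.empty] by simp

section \<open>Matrix powers and the exponential of an involution\<close>

lemma mpow_0 [simp]: "mpow A 0 = mat 1"
  and mpow_Suc: "mpow A (Suc k) = A ** mpow A k"
  by (simp_all add: mpow_def)

lemma mpow_cscale: "mpow (cscale c A) k = cscale (c ^ k) (mpow A k)"
  by (induction k) (simp_all add: mpow_Suc cscale_mult_left cscale_mult_right mult.commute)

lemma mpow_add: "mpow A (j + k) = mpow A j ** mpow A k"
  by (induction j) (simp_all add: mpow_Suc matrix_mul_assoc)

text \<open>Euler's formula: even powers of \<open>A\<close> are the identity and odd powers are
  \<open>A\<close>.\<close>

lemma mexp_involution:
  fixes A :: "complex^'a::finite^'a"
  assumes "A ** A = mat 1"
  shows "mexp (cscale (\<i> * of_real \<theta>) A) = cos \<theta> *\<^sub>R mat 1 + sin \<theta> *\<^sub>R cscale \<i> A"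
proof -
  have pow: "mpow A (2 * m) = mat 1" "mpow A (Suc (2 * m)) = A" for m
    by (induction m) (simp_all add: mpow_Suc assms)
  \<comment> \<open>For each \<open>k\<close> one summand is zero, as \<open>cos_coeff\<close>
    vanishes at odd and \<open>sin_coeff\<close> at even indices.\<close>
  have "mpow (cscale (\<i> * of_real \<theta>) A) k /\<^sub>R fact k =
      (cos_coeff k *\<^sub>R \<theta> ^ k) *\<^sub>R mat 1 + (sin_coeff k *\<^sub>R \<theta> ^ k) *\<^sub>R cscale \<i> A" for k
  proof (cases "even k")
    case True
    then obtain m where k: "k = 2 * m" by auto
    have "cscale ((\<i> * of_real \<theta>) ^ k) (mat 1) = ((-1) ^ m * \<theta> ^ k) *\<^sub>R (mat 1 :: complex^'a^'a)"
      unfolding k cscale_of_real[symmetric] by (simp add: power_mult_distrib power_mult flip: power_minus)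
    then show ?thesis
      using pow(1)[of m] by (simp add: mpow_cscale k cos_coeff_def sin_coeff_def divide_inverse mult_ac)
  next
    case False
    then obtain m where k: "k = Suc (2 * m)" by (auto elim: oddE)
    have "\<i> ^ (2 * m) = (-1) ^ m"
      by (simp add: power_mult)
    then have "cscale ((\<i> * of_real \<theta>) ^ k) A = ((-1) ^ m * \<theta> ^ k) *\<^sub>R cscale \<i> A"
      unfolding k cscale_of_real[symmetric] by (simp add: power_mult_distrib mult_ac)
    then show ?thesis
      using pow(2)[of m] by (simp add: mpow_cscale k cos_coeff_def sin_coeff_def divide_inverse mult_ac)
  qed
  moreover have "(\<lambda>k. (cos_coeff k *\<^sub>R \<theta> ^ k) *\<^sub>R (mat 1 :: complex^'a^'a)
      + (sin_coeff k *\<^sub>R \<theta> ^ k) *\<^sub>R cscale \<i> A) sums (cos \<theta> *\<^sub>R mat 1 + sin \<theta> *\<^sub>R cscale \<i> A)"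
    by (intro sums_add bounded_linear.sums[OF bounded_linear_scaleR_left] cos_converges sin_converges)
  ultimately show ?thesis
    by (simp add: mexp_def sums_iff)
qed

section \<open>Unitaries whose controlled version has a circuit of given cost\<close>

definition implementable :: "nat \<Rightarrow> 'n::finite qop \<Rightarrow> bool"
  where "implementable r U \<longleftrightarrow> unitary U \<and> circuit r (controlled U)"

lemma implementable_mult:
  "implementable r U \<Longrightarrow> implementable s V \<Longrightarrow> implementable (r + s) (U ** V)"
  unfolding implementable_def using unitary_mult circuit_append by (metis controlled_mult)

lemma implementable_mat_1: "implementable 0 (mat 1)"
  unfolding implementable_def
  by (simp add: controlled_mat_1 circuit.empty unitary_pauli_ops mat_1_in_pauli_ops)

lemma implementable_pauli: "P \<in> pauli_ops \<Longrightarrow> implementable 0 P"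
  unfolding implementable_def
  by (simp add: unitary_pauli_ops circuit_clifford clifford_controlled_pauli)

lemma circuit_single_site_rotation:
  fixes q :: "'n::finite"
  assumes "B \<in> pauli1"
  shows "circuit 1 (controlled (cos \<theta> *\<^sub>R mat 1 + sin \<theta> *\<^sub>R cscale \<i> (tensor ((\<lambda>_. mat 1)(q := B)))))"
proof -
  have "circuit (Suc 0) (controlled1 None (Some q) (mexp (cscale (\<i> * of_real \<theta>) B)) ** mat 1)"
    by (rule circuit.rotation[OF circuit.empty _ assms]) simp
  moreover have "tensor ((\<lambda>_. mat 1)(q := mexp (cscale (\<i> * of_real \<theta>) B))) =
      cos \<theta> *\<^sub>R mat 1 + sin \<theta> *\<^sub>R cscale \<i> (tensor ((\<lambda>_. mat 1)(q := B)))"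
    by (simp add: mexp_involution pauli1_square[OF assms] tensor_upd_add tensor_upd_cscale
      fun_upd_idem flip: cscale_of_real)
  ultimately show ?thesis
    by (simp add: controlled1_None_Some)
qed

lemma implementable_pauli_rotation:
  fixes P :: "'n::finite qop"
  assumes "P \<in> pauli_ops"
  shows "implementable 1 (cos \<theta> *\<^sub>R mat 1 + sin \<theta> *\<^sub>R cscale \<i> P)" (is "implementable 1 ?U")
  unfolding implementable_def
proof
  define J where "J = cscale \<i> P"
  have J: "J ** J = - mat 1" "adj J = - J"
    by (simp_all add: J_def cscale_mult_left cscale_mult_right pauli_ops_square adj_pauli_ops assms)
  \<comment> \<open>\<open>J\<close> is anti-Hermitian with square \<open>-1\<close>, so unitarity
    comes down to this identity.\<close>
  have "cos \<theta> *\<^sub>R cos \<theta> *\<^sub>R mat 1 + sin \<theta> *\<^sub>R sin \<theta> *\<^sub>R mat 1 = (mat 1 :: 'n qop)"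
    by (simp add: scaleR_add_left[symmetric] flip: power2_eq_square)
  then show "unitary ?U"
    by (simp add: unitary_def matrix_bilinear J algebra_simps flip: J_def)
  obtain s A where P: "P = s *\<^sub>R tensor A" "s \<in> {1, -1}" "\<And>q. A q \<in> pauli1"
    using assms by (auto simp: pauli_ops_def)
  \<comment> \<open>The sign of \<open>P\<close> is absorbed into the angle, as cosine is even and
    sine is odd.\<close>
  have U: "?U = cos (s * \<theta>) *\<^sub>R mat 1 + sin (s * \<theta>) *\<^sub>R cscale \<i> (tensor A)"
    using P(2) by (auto simp: P(1) cscale_scaleR)
  show "circuit 1 (controlled ?U)"
  proof (cases "\<forall>q. A q = mat 1")
    case True
    \<comment> \<open>The count must be exactly one even here, so the rotation is about
      \<open>mat 1\<close>, targeting an arbitrary qubit.\<close>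
    then have "A = (\<lambda>_. mat 1)(undefined := mat 1)"
      by auto
    then show ?thesis
      unfolding U using circuit_single_site_rotation[of "mat 1" "s * \<theta>" undefined]
      by (simp add: pauli1_def)
  next
    case False
    then obtain q where q: "A q \<noteq> mat 1" by blast
    obtain B where B: "B \<in> pauli1" "A q ** B = - (B ** A q)"
      using pauli1_anticommuting[OF P(3) q] by blast
    \<comment> \<open>\<open>Q\<close> differs from the identity at most at \<open>q\<close>, so its
      anticommutation with \<open>tensor A\<close> is decided there.\<close>
    define Q where "Q = tensor ((\<lambda>_. mat 1)(q := B))"
    have T: "tensor A \<in> pauli_ops"
      by (simp add: P(3) tensor_in_pauli_ops)
    have Q: "Q \<in> pauli_ops"
      unfolding Q_def by (rule tensor_in_pauli_ops) (simp add: B(1), simp add: pauli1_def)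
    have "Q ** tensor A = - (tensor A ** Q)"
    proof -
      have "Q ** tensor A = tensor (A(q := B ** A q))"
        unfolding Q_def tensor_mult by (rule arg_cong[of _ _ tensor]) auto
      also have "B ** A q = cscale (-1) (A q ** B)"
        by (simp add: B(2))
      also have "tensor (A(q := cscale (-1) (A q ** B))) = - tensor (A(q := A q ** B))"
        by (simp only: tensor_upd_cscale) simp
      also have "tensor (A(q := A q ** B)) = tensor A ** Q"
        unfolding Q_def tensor_mult by (rule arg_cong[of _ _ tensor]) auto
      finally show ?thesis .
    qed
    note AQ = T Q this
    define C where "C = (1 / sqrt 2) *\<^sub>R (tensor A + Q)"
    note C = clifford_anticommuting_pauli_ops[OF AQ, folded C_def]
    \<comment> \<open>On the enlarged register this is again the normalized sum of two anticommuting
      Pauli operators.\<close>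
    have "clifford (otimes (mat 1) C)"
    proof -
      have "otimes (mat 1) Q ** otimes (mat 1) (tensor A) = - (otimes (mat 1) (tensor A) ** otimes (mat 1) Q)"
        by (simp add: otimes_mult AQ(3))
      then show ?thesis
        using clifford_anticommuting_pauli_ops(1)[OF otimes_in_pauli_ops otimes_in_pauli_ops, of "mat 1" "tensor A" "mat 1" Q] AQ
        by (simp add: C_def pauli1_def)
    qed
    then have "circuit 0 (otimes (mat 1) C)"
      by (rule circuit_clifford)
    moreover have "?U = C ** (cos (s * \<theta>) *\<^sub>R mat 1 + sin (s * \<theta>) *\<^sub>R cscale \<i> Q) ** C"
      by (simp add: U matrix_bilinear cscale_mult_left cscale_mult_right C)
    ultimately show ?thesis
      using circuit_append[OF circuit_append[OF _ circuit_single_site_rotation[OF B(1), of "s * \<theta>" q]]]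
      by (simp add: controlled_conjugate C(2) flip: Q_def) force
  qed
qed

subsection \<open>The matrix exponential\<close>

text \<open>A Fubini rule: absolute summability makes the joint sum exist, and uniqueness identifies
  it with the iterated one.\<close>

lemma has_sum_SigmaI:
  fixes f :: "'i \<times> 'j \<Rightarrow> 'b::banach"
  assumes "(\<lambda>p. norm (f p)) summable_on Sigma I J"
    and "\<And>i. i \<in> I \<Longrightarrow> ((\<lambda>j. f (i, j)) has_sum g i) (J i)" and "(g has_sum s) I"
  shows "(f has_sum s) (Sigma I J)"
proof -
  have f: "(f has_sum infsum f (Sigma I J)) (Sigma I J)"
    by (rule has_sum_infsum[OF abs_summable_summable[OF assms(1)]])
  then have "(g has_sum infsum f (Sigma I J)) I"
    by (rule has_sum_SigmaD) (rule assms(2))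
  then have "infsum f (Sigma I J) = s"
    using assms(3) by (rule has_sum_unique)
  then show ?thesis
    using f by simp
qed

text \<open>The Tonelli counterpart: for nonnegative terms the iterated sums already give absolute
  summability.\<close>

lemma nonneg_has_sum_SigmaI:
  fixes f :: "'i \<times> 'j \<Rightarrow> real"
  assumes nonneg: "\<And>i j. i \<in> I \<Longrightarrow> j \<in> J i \<Longrightarrow> f (i, j) \<ge> 0"
    and f: "\<And>i. i \<in> I \<Longrightarrow> ((\<lambda>j. f (i, j)) has_sum g i) (J i)" and g: "(g has_sum s) I"
  shows "(f has_sum s) (Sigma I J)"
proof (rule has_sum_SigmaI)
  have f': "((\<lambda>j. norm (f (i, j))) has_sum g i) (J i)" if "i \<in> I" for i
    using f[OF that] by (rule has_sum_cong[THEN iffD1, rotated]) (simp add: nonneg that)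
  have "norm (infsum (\<lambda>j. norm (f (i, j))) (J i)) = g i" if "i \<in> I" for i
  proof -
    have "g i \<ge> 0"
      by (rule has_sum_nonneg[OF f'[OF that]]) simp
    then show ?thesis
      unfolding infsumI[OF f'[OF that]] by simp
  qed
  then have "((\<lambda>i. norm (infsum (\<lambda>j. norm (f (i, j))) (J i))) has_sum s) I"
    by (subst has_sum_cong, assumption) (rule g)
  then have "(\<lambda>i. norm (infsum (\<lambda>j. norm (f (i, j))) (J i))) summable_on I"
    by (rule has_sum_imp_summable)
  then show "(\<lambda>p. norm (f p)) summable_on Sigma I J"
    unfolding Infinite_Sum.abs_summable_on_Sigma_iff
    by (intro conjI ballI) (erule has_sum_imp_summable[OF f'])
qed (fact f g)+

section \<open>Convergence and functional equation of the matrix exponential\<close>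

lemma mpow_bound:
  fixes A :: "complex^'a::finite^'a"
  obtains c x where "\<And>k. norm (mpow A k) \<le> c * x ^ k"
proof -
  obtain K where K: "K \<ge> 0" "\<And>X Y. norm ((X :: complex^'a^'a) ** (Y :: complex^'a^'a)) \<le> norm X * norm Y * K"
    using bounded_bilinear.nonneg_bounded[OF bounded_bilinear_matrix_mult] by blast
  \<comment> \<open>The constant \<open>K\<close> of the product goes into the base; geometric
    growth is enough against the factorial.\<close>
  have "norm (mpow A k) \<le> norm (mat 1 :: complex^'a^'a) * (norm A * K) ^ k" for k
  proof (induction k)
    case (Suc k)
    have "norm (mpow A (Suc k)) \<le> norm A * K * norm (mpow A k)"
      using K(2)[of A "mpow A k"] by (simp add: mpow_Suc mult_ac)
    also have "\<dots> \<le> norm A * K * (norm (mat 1 :: complex^'a^'a) * (norm A * K) ^ k)"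
      using Suc K(1) by (intro mult_left_mono) auto
    finally show ?case by (simp add: mult_ac)
  qed simp
  then show ?thesis
    by (rule that)
qed

lemma mexp_norm_summable: "summable (\<lambda>k. norm (mpow A k /\<^sub>R fact k))"
  for A :: "complex^'a::finite^'a"
proof -
  obtain c x where cx: "\<And>k. norm (mpow A k) \<le> c * x ^ k"
    using mpow_bound[of A] by blast
  show ?thesis
  proof (rule summable_comparison_test')
    show "summable (\<lambda>k. c * (inverse (fact k) * x ^ k))"
      by (intro summable_mult summable_exp)
    show "norm (norm (mpow A k /\<^sub>R fact k)) \<le> c * (inverse (fact k) * x ^ k)" for k
      using mult_left_mono[OF cx[of k], of "inverse (fact k)"] by (simp add: mult_ac)
  qed
qed

lemma mexp_sums: "(\<lambda>k. mpow A k /\<^sub>R fact k) sums mexp A"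
  for A :: "complex^'a::finite^'a"
  unfolding mexp_def by (rule summable_sums[OF summable_norm_cancel[OF mexp_norm_summable]])

lemma mexp_has_sum: "((\<lambda>k. mpow A k /\<^sub>R fact k) has_sum mexp A) UNIV"
  for A :: "complex^'a::finite^'a"
  by (rule norm_summable_imp_has_sum[OF mexp_norm_summable mexp_sums])

lemma mexp_0: "mexp 0 = (mat 1 :: complex^'a::finite^'a)"
proof -
  have "cscale (\<i> * of_real 0) (mat 1) = (0 :: complex^'a^'a)"
    by (simp add: cscale_def vec_eq_iff)
  then show ?thesis
    using mexp_involution[of "mat 1 :: complex^'a^'a" 0] by simp
qed

text \<open>The Cauchy product of two absolutely convergent series. Both arguments are multiples of
  one \<open>A\<close>, so the terms of equal total degree combine by the scalar binomial
  theorem.\<close>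

lemma mexp_cscale_add:
  fixes A :: "complex^'a::finite^'a"
  shows "mexp (cscale a A) ** mexp (cscale b A) = mexp (cscale (a + b) A)"
proof -
  define f g where "f = (\<lambda>j. mpow (cscale a A) j /\<^sub>R fact j)" and "g = (\<lambda>j. mpow (cscale b A) j /\<^sub>R fact j)"
  note bb = bounded_bilinear_matrix_mult
  have f: "(f has_sum mexp (cscale a A)) UNIV" and g: "(g has_sum mexp (cscale b A)) UNIV"
    unfolding f_def g_def by (rule mexp_has_sum)+
  have fn: "(\<lambda>j. norm (f j)) summable_on UNIV" and gn: "(\<lambda>j. norm (g j)) summable_on UNIV"
    unfolding f_def g_def by (simp_all only: summable_on_UNIV_nonneg_real_iff norm_ge_zero mexp_norm_summable)
  obtain K where K: "K \<ge> 0" "\<And>X Y. norm ((X :: complex^'a^'a) ** (Y :: complex^'a^'a)) \<le> norm X * norm Y * K"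
    using bounded_bilinear.nonneg_bounded[OF bb] by blast
  have "((\<lambda>p. norm (f (fst p)) * norm (g (snd p)) * K) has_sum (\<Sum>\<^sub>\<infinity>j. norm (f j)) * (\<Sum>\<^sub>\<infinity>j. norm (g j)) * K) (UNIV \<times> UNIV)"
  proof (rule nonneg_has_sum_SigmaI)
    show "((\<lambda>j. norm (f (fst (i, j))) * norm (g (snd (i, j))) * K) has_sum norm (f i) * (\<Sum>\<^sub>\<infinity>j. norm (g j)) * K) UNIV" for i
      unfolding fst_conv snd_conv by (intro has_sum_cmult_left has_sum_cmult_right has_sum_infsum gn)
    show "((\<lambda>i. norm (f i) * (\<Sum>\<^sub>\<infinity>j. norm (g j)) * K) has_sum (\<Sum>\<^sub>\<infinity>j. norm (f j)) * (\<Sum>\<^sub>\<infinity>j. norm (g j)) * K) UNIV"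
      by (intro has_sum_cmult_left has_sum_infsum fn)
  qed (use K(1) in simp)
  then have "(\<lambda>p. norm (f (fst p)) * norm (g (snd p)) * K) summable_on (UNIV \<times> UNIV)"
    by (rule has_sum_imp_summable)
  then have *: "(\<lambda>p. norm (norm (f (fst p)) * norm (g (snd p)) * K)) summable_on (UNIV \<times> UNIV)"
    using K(1) by (simp add: abs_mult)
  have "((\<lambda>p. f (fst p) ** g (snd p)) has_sum mexp (cscale a A) ** mexp (cscale b A)) (UNIV \<times> UNIV)"
  proof (rule has_sum_SigmaI)
    show "(\<lambda>p. norm (f (fst p) ** g (snd p))) summable_on UNIV \<times> UNIV"
      using * by (rule Infinite_Sum.abs_summable_on_comparison_test) (use K in simp)
    show "((\<lambda>j. f (fst (i, j)) ** g (snd (i, j))) has_sum f i ** mexp (cscale b A)) UNIV" for i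
      unfolding fst_conv snd_conv
      by (rule has_sum_bounded_linear[OF bounded_bilinear.bounded_linear_right[OF bb] g])
    show "((\<lambda>i. f i ** mexp (cscale b A)) has_sum mexp (cscale a A) ** mexp (cscale b A)) UNIV"
      by (rule has_sum_bounded_linear[OF bounded_bilinear.bounded_linear_left[OF bb] f])
  qed
  \<comment> \<open>Pairs are regrouped along antidiagonals, with \<open>n\<close> the total
    degree.\<close>
  moreover have "bij_betw (\<lambda>(n, k). (k, n - k)) (SIGMA n:UNIV. {..n}) (UNIV \<times> UNIV :: (nat \<times> nat) set)"
    by (rule bij_betw_byWitness[where f' = "\<lambda>(j, k). (j + k, j)"]) auto
  ultimately have "((\<lambda>p. f (fst (case_prod (\<lambda>n k. (k, n - k)) p)) ** g (snd (case_prod (\<lambda>n k. (k, n - k)) p)))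
      has_sum mexp (cscale a A) ** mexp (cscale b A)) (SIGMA n:UNIV. {..n})"
    by (subst has_sum_reindex_bij_betw[where g = "\<lambda>(n, k). (k, n - k)" and f = "\<lambda>p. f (fst p) ** g (snd p)"])
  then have "((\<lambda>n. \<Sum>k\<le>n. f k ** g (n - k)) has_sum mexp (cscale a A) ** mexp (cscale b A)) UNIV"
    by (rule has_sum_SigmaD) simp
  moreover have "(\<Sum>k\<le>n. f k ** g (n - k)) = mpow (cscale (a + b) A) n /\<^sub>R fact n" for n
  proof -
    have sum: "(\<Sum>k\<in>I. cscale (c k) A') = cscale (\<Sum>k\<in>I. c k) A'" for I :: "nat set" and c and A' :: "complex^'a^'a"
      by (simp add: cscale_def vec_eq_iff sum_distrib_right)
    have re: "r *\<^sub>R cscale c A' = cscale (r *\<^sub>R c) A'" for r c and A' :: "complex^'a^'a"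
      by (simp add: cscale_def vec_eq_iff)
    have "f k ** g (n - k) = cscale (a ^ k /\<^sub>R fact k * (b ^ (n - k) /\<^sub>R fact (n - k))) (mpow A n)"
      if "k \<le> n" for k
      using mpow_add[of A k "n - k"] that
      by (simp add: f_def g_def mpow_cscale re cscale_mult_left cscale_mult_right mult_ac)
    then have "(\<Sum>k\<le>n. f k ** g (n - k)) =
        cscale (\<Sum>k\<le>n. a ^ k /\<^sub>R fact k * (b ^ (n - k) /\<^sub>R fact (n - k))) (mpow A n)"
      by (simp only: sum[symmetric] cong: sum.cong) simp
    also have "\<dots> = mpow (cscale (a + b) A) n /\<^sub>R fact n"
      by (simp only: exp_series_add_commuting[where x = a and y = b and n = n, OF mult.commute, symmetric] mpow_cscale re)
    finally show ?thesis .
  qed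
  ultimately have "((\<lambda>n. mpow (cscale (a + b) A) n /\<^sub>R fact n) has_sum mexp (cscale a A) ** mexp (cscale b A)) UNIV"
    by simp
  then show ?thesis
    using mexp_has_sum by (rule has_sum_unique)
qed

lemma mpow_mexp: "mpow (mexp (cscale c A)) r = mexp (cscale (of_nat r * c) A)"
  for A :: "complex^'a::finite^'a"
proof (induction r)
  case 0
  have "cscale 0 A = 0"
    by (simp add: cscale_def vec_eq_iff)
  then show ?case by (simp add: mexp_0)
next
  case (Suc r)
  then show ?case by (simp add: mpow_Suc mexp_cscale_add algebra_simps)
qed

subsection \<open>Weighted decompositions into implementable unitaries\<close>

text \<open>The norm is the Frobenius norm, and each row of \<open>U\<close> is a unit vector by the
  diagonal of \<open>U ** adj U\<close>. All unitaries thus have equal norm, so summable weights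
  force absolute convergence.\<close>

lemma norm_unitary:
  fixes U :: "complex^'a::finite^'a"
  assumes "unitary U"
  shows "norm U = sqrt CARD('a)"
proof -
  have "(norm (U $ i))\<^sup>2 = 1" for i
  proof -
    have "of_real ((norm (U $ i))\<^sup>2) = (U ** adj U) $ i $ i"
      by (simp add: norm_vec_def L2_set_def sum_nonneg matrix_matrix_mult_def adj_def
         complex_norm_square del: of_real_power)
    also have "\<dots> = 1"
      using assms by (simp add: unitary_def mat_def)
    finally show ?thesis
      using of_real_eq_1_iff by blast
  qed
  then show ?thesis
    by (simp add: norm_vec_def[of U] L2_set_def)
qed

lemma op_norm_bound:
  obtains K where "\<And>A :: complex^'a::finite^'a. 0 \<le> op_norm A \<and> op_norm A \<le> K * norm A"
proof -
  have "bilinear ((*v) :: complex^'a^'a \<Rightarrow> complex^'a \<Rightarrow> complex^'a)"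
    unfolding bilinear_def linear_iff
    by (auto simp: vec_eq_iff matrix_vector_mult_def algebra_simps sum.distrib scaleR_sum_right)
  then have bb: "bounded_bilinear ((*v) :: complex^'a^'a \<Rightarrow> complex^'a \<Rightarrow> complex^'a)"
    by (simp add: bilinear_conv_bounded_bilinear)
  then obtain K where K: "\<And>(A :: complex^'a^'a) v. norm (A *v v) \<le> norm A * norm v * K"
    using bounded_bilinear.bounded by blast
  have "op_norm A \<le> K * norm A" for A :: "complex^'a^'a"
    unfolding op_norm_def by (rule onorm_le) (use K in \<open>simp add: mult_ac\<close>)
  moreover have "0 \<le> op_norm A" for A :: "complex^'a^'a"
    unfolding op_norm_def by (rule onorm_pos_le[OF bounded_bilinear.bounded_linear_right[OF bb]])
  ultimately show ?thesis
    using that by blast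
qed

text \<open>Indices are naturals because an existential cannot range over types;
  \<open>decomposableI_countable\<close> admits any countable index set. The total weight
  \<open>s\<close> is exact.\<close>

definition decomposable :: "nat \<Rightarrow> real \<Rightarrow> 'n::finite qop \<Rightarrow> bool"
  where "decomposable r s A \<longleftrightarrow> (\<exists>(S :: nat set) b U. (\<forall>k\<in>S. b k > 0 \<and> implementable r (U k)) \<and>
    (b has_sum s) S \<and> ((\<lambda>k. b k *\<^sub>R U k) has_sum A) S)"

lemma decomposableI_countable:
  fixes S :: "'i set"
  assumes "countable S" "\<And>k. k \<in> S \<Longrightarrow> b k > 0 \<and> implementable r (U k)"
    and "(b has_sum s) S" "((\<lambda>k. b k *\<^sub>R U k) has_sum A) S"
  shows "decomposable r s A"
proof -
  obtain g :: "'i \<Rightarrow> nat" where g: "inj_on g S"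
    using assms(1) by (rule countableE)
  define T h where "T = g ` S" and "h = inv_into S g"
  have T: "bij_betw h T S"
    unfolding T_def h_def by (rule bij_betw_inv_into[OF inj_on_imp_bij_betw[OF g]])
  then have "h k \<in> S" if "k \<in> T" for k
    using that by (auto simp: bij_betw_def)
  then show ?thesis
    unfolding decomposable_def using assms(2-)
    by (intro exI[of _ T] exI[of _ "\<lambda>k. b (h k)"] exI[of _ "\<lambda>k. U (h k)"])
      (auto simp: has_sum_reindex_bij_betw[OF T] has_sum_reindex_bij_betw[OF T, of "\<lambda>k. b k *\<^sub>R U k"])
qed

lemma decomposable_implementable: "implementable r U \<Longrightarrow> decomposable r 1 U"
  by (rule decomposableI_countable[of "{()}" "\<lambda>_. 1" r "\<lambda>_. U"]) (auto intro: has_sum_finiteI)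

lemma decomposable_nonneg: "decomposable r s A \<Longrightarrow> s \<ge> 0"
  unfolding decomposable_def by (metis has_sum_nonneg less_imp_le)

text \<open>The triangle inequality with terms of constant norm; it later turns summable weights
  into convergence of the paired Taylor series.\<close>

lemma decomposable_norm_le:
  assumes "decomposable r s (A :: 'n::finite qop)"
  shows "norm A \<le> s * sqrt CARD('n \<Rightarrow> bool)"
proof -
  obtain S :: "nat set" and b U where S: "\<And>k. k \<in> S \<Longrightarrow> b k > 0 \<and> implementable r (U k)"
    "(b has_sum s) S" "((\<lambda>k. b k *\<^sub>R U k) has_sum A) S"
    using assms unfolding decomposable_def by blast
  have "norm (b k *\<^sub>R U k) = b k * sqrt CARD('n \<Rightarrow> bool)" if "k \<in> S" for k
    using S(1)[OF that] norm_unitary[of "U k"] by (simp add: implementable_def)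
  then have "((\<lambda>k. norm (b k *\<^sub>R U k)) has_sum s * sqrt CARD('n \<Rightarrow> bool)) S"
    by (subst has_sum_cong, assumption) (rule has_sum_cmult_left[OF S(2)])
  then show ?thesis
    using S(3) by (rule norm_has_sum_bound)
qed

text \<open>A sum of sums is flattened over pairs of indices. The weights add up by nonnegativity,
  and they dominate the operators.\<close>

lemma decomposable_has_sum:
  fixes J :: "'i set" and A :: "'i \<Rightarrow> 'n::finite qop"
  assumes "countable J" and dec: "\<And>j. j \<in> J \<Longrightarrow> decomposable r (s j) (A j)"
    and s: "(s has_sum s') J" and A: "(A has_sum A') J"
  shows "decomposable r s' A'"
proof -
  define Q where "Q j S b U \<longleftrightarrow> (\<forall>k\<in>S. b k > 0 \<and> implementable r (U k)) \<and>
    (b has_sum s j) S \<and> ((\<lambda>k. b k *\<^sub>R U k) has_sum A j) S" for j and S :: "nat set" and b U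
  \<comment> \<open>The condition on \<open>j\<close> sits inside the existential so that the choice
    functions are total.\<close>
  have "\<forall>j. \<exists>S b U. j \<in> J \<longrightarrow> Q j S b U"
    using dec unfolding decomposable_def Q_def by blast
  then obtain S b U where Q: "\<And>j. j \<in> J \<Longrightarrow> Q j (S j) (b j) (U j)"
    by metis
  have S: "\<And>j k. j \<in> J \<Longrightarrow> k \<in> S j \<Longrightarrow> b j k > 0 \<and> implementable r (U j k)"
    "\<And>j. j \<in> J \<Longrightarrow> (b j has_sum s j) (S j)"
    "\<And>j. j \<in> J \<Longrightarrow> ((\<lambda>k. b j k *\<^sub>R U j k) has_sum A j) (S j)"
    using Q unfolding Q_def by blast+
  have pos: "case_prod b k > 0 \<and> implementable r (case_prod U k)" if "k \<in> Sigma J S" for k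
    using that S(1) by auto
  have bsum: "(case_prod b has_sum s') (Sigma J S)"
  proof (rule nonneg_has_sum_SigmaI[OF _ _ s])
    show "case_prod b (j, k) \<ge> 0" if "j \<in> J" "k \<in> S j" for j k
      using S(1)[OF that] by simp
    show "((\<lambda>k. case_prod b (j, k)) has_sum s j) (S j)" if "j \<in> J" for j
      using S(2)[OF that] by simp
  qed
  show ?thesis
  proof (rule decomposableI_countable)
    show "countable (Sigma J S)"
      using \<open>countable J\<close> by (simp add: countable_SIGMA)
    show "case_prod b k > 0 \<and> implementable r (case_prod U k)" if "k \<in> Sigma J S" for k
      using that by (rule pos)
    show "(case_prod b has_sum s') (Sigma J S)"
      by (rule bsum)
    show "((\<lambda>k. case_prod b k *\<^sub>R case_prod U k) has_sum A') (Sigma J S)"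
    proof (rule has_sum_SigmaI[OF _ _ A])
      have "norm (case_prod b k *\<^sub>R case_prod U k) = case_prod b k * sqrt CARD('n \<Rightarrow> bool)"
        if "k \<in> Sigma J S" for k
        using pos[OF that] norm_unitary[of "case_prod U k"] by (simp add: implementable_def)
      then show "(\<lambda>k. norm (case_prod b k *\<^sub>R case_prod U k)) summable_on Sigma J S"
        by (subst summable_on_cong, assumption)
          (rule has_sum_imp_summable[OF has_sum_cmult_left[OF bsum]])
      show "((\<lambda>k. case_prod b (j, k) *\<^sub>R case_prod U (j, k)) has_sum A j) (S j)" if "j \<in> J" for j
        using S(3)[OF that] by simp
    qed
  qed
qed

section \<open>Closure under scaling, products, powers and convex combinations\<close>

lemma decomposable_scaleR:
  assumes "decomposable r s A" "c \<ge> 0"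
  shows "decomposable r (c * s) (c *\<^sub>R A)"
proof (cases "c = 0")
  case True
  \<comment> \<open>Weights must be positive, so the zero operator gets the empty index set.\<close>
  show ?thesis
    by (rule decomposableI_countable[of "{} :: nat set"]) (simp_all add: True)
next
  case False
  obtain S :: "nat set" and b U where "\<forall>k\<in>S. b k > 0 \<and> implementable r (U k)"
    and b: "(b has_sum s) S" and U: "((\<lambda>k. b k *\<^sub>R U k) has_sum A) S"
    using assms(1) unfolding decomposable_def by blast
  moreover have "((\<lambda>k. (c * b k) *\<^sub>R U k) has_sum c *\<^sub>R A) S"
    using has_sum_scaleR[OF U, of c] by simp
  ultimately show ?thesis
    using has_sum_cmult_right[OF b, of c] False assms(2)
    by (intro decomposableI_countable[of S "\<lambda>k. c * b k" r U]) auto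
qed

lemma decomposable_mult:
  assumes "decomposable r s A" "decomposable r' s' B"
  shows "decomposable (r + r') (s * s') (A ** B)"
proof -
  obtain S :: "nat set" and b U where S: "\<And>k. k \<in> S \<Longrightarrow> b k > 0 \<and> implementable r (U k)"
    and b: "(b has_sum s) S" and U: "((\<lambda>k. b k *\<^sub>R U k) has_sum A) S"
    using assms(1) unfolding decomposable_def by blast
  obtain S' :: "nat set" and b' U' where S': "\<And>k. k \<in> S' \<Longrightarrow> b' k > 0 \<and> implementable r' (U' k)"
    and b': "(b' has_sum s') S'" and U': "((\<lambda>k. b' k *\<^sub>R U' k) has_sum B) S'"
    using assms(2) unfolding decomposable_def by blast
  note bb = bounded_bilinear_matrix_mult
  show ?thesis
  \<comment> \<open>Only \<open>A\<close> is expanded here; each \<open>U k ** B\<close> inherits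
    the decomposition of \<open>B\<close>.\<close>
  proof (rule decomposable_has_sum)
    fix k assume k: "k \<in> S"
    have "decomposable (r + r') s' (U k ** B)"
    proof (rule decomposableI_countable)
      show "((\<lambda>j. b' j *\<^sub>R (U k ** U' j)) has_sum U k ** B) S'"
        using has_sum_bounded_linear[OF bounded_bilinear.bounded_linear_right[OF bb] U', of "U k"]
        by (simp add: matrix_bilinear)
      show "b' j > 0 \<and> implementable (r + r') (U k ** U' j)" if "j \<in> S'" for j
        using S[OF k] S'[OF that] implementable_mult by blast
    qed (use b' in auto)
    then show "decomposable (r + r') (b k * s') ((b k *\<^sub>R U k) ** B)"
      using S[OF k] decomposable_scaleR[of "r + r'" s' "U k ** B" "b k"] by (simp add: matrix_bilinear)
  next
    show "((\<lambda>k. b k * s') has_sum s * s') S"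
      by (rule has_sum_cmult_left[OF b])
    show "((\<lambda>k. (b k *\<^sub>R U k) ** B) has_sum A ** B) S"
      by (rule has_sum_bounded_linear[OF bounded_bilinear.bounded_linear_left[OF bb] U])
  qed auto
qed

lemma decomposable_mpow:
  "decomposable r s A \<Longrightarrow> decomposable (k * r) (s ^ k) (mpow A k)"
  by (induction k)
    (auto simp: mpow_Suc decomposable_implementable implementable_mat_1 intro: decomposable_mult)

lemma decomposable_convex:
  assumes "finite L" "\<And>l. l \<in> L \<Longrightarrow> p l > 0" "(\<Sum>l\<in>L. p l) = 1"
    and "\<And>l. l \<in> L \<Longrightarrow> decomposable r s (A l)"
  shows "decomposable r s (\<Sum>l\<in>L. p l *\<^sub>R A l)"
proof (rule decomposable_has_sum)
  show "decomposable r (p l * s) (p l *\<^sub>R A l)" if "l \<in> L" for l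
    using assms(2,4)[OF that] by (intro decomposable_scaleR) auto
  show "((\<lambda>l. p l * s) has_sum s) L"
    using assms(1,3) by (intro has_sum_finiteI) (simp_all flip: sum_distrib_right)
qed (use assms(1) in \<open>auto intro: countable_finite has_sum_finiteI\<close>)

subsection \<open>The Taylor series\<close>

text \<open>Each of the two fractions is at most \<open>1 / (2 * fact m)\<close>.\<close>

lemma taylor_coefficient_le:
  assumes "m \<ge> 1"
  shows "1 / fact (2 * m) + 1 / (2 * fact (2 * m - 2) * (2 * real m - 1)\<^sup>2) \<le> 1 / (fact m :: real)"
proof -
  obtain n where m: "m = Suc n"
    using assms by (cases m) auto
  have "fact n \<le> (fact (2 * n) :: real)"
    by (rule fact_mono) simp
  \<comment> \<open>Factor by factor, with \<open>m = n + 1\<close>: \<open>n!\<close> against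
    \<open>(2n)!\<close>, and \<open>n + 1\<close> against \<open>(2n + 1)\<^sup>2\<close>.\<close>
  then have *: "fact m \<le> fact (2 * n) * (2 * real n + 1)\<^sup>2"
    unfolding m fact_Suc of_nat_Suc
    by (subst mult.commute, intro mult_mono) (auto simp: power2_eq_square algebra_simps)
  have pos: "0 < fact (2 * n) * (2 * real n + 1)\<^sup>2"
    by (intro mult_pos_pos) (auto simp: add_pos_nonneg)
  have "2 * fact m \<le> (fact (2 * m) :: real)"
  proof -
    have "fact m \<le> (fact (Suc (2 * n)) :: real)"
      unfolding m by (rule fact_mono) simp
    then have "2 * fact m \<le> (real (2 * n) + 2) * fact (Suc (2 * n))"
      by (intro mult_mono) auto
    then show ?thesis
      by (simp add: m algebra_simps)
  qed
  then have "1 / fact (2 * m) \<le> 1 / (2 * fact m :: real)"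
    by (intro divide_left_mono) auto
  moreover have "1 / (2 * fact (2 * m - 2) * (2 * real m - 1)\<^sup>2) \<le> 1 / (2 * fact m)"
  proof (rule divide_left_mono)
    show "2 * fact m \<le> 2 * fact (2 * m - 2) * (2 * real m - 1)\<^sup>2"
      using * by (simp add: m algebra_simps)
    have "0 < 2 * fact (2 * m - 2) * (2 * real m - 1)\<^sup>2"
      using pos by (simp add: m algebra_simps)
    then show "0 < 2 * fact (2 * m - 2) * (2 * real m - 1)\<^sup>2 * (2 * fact m)"
      by simp
  qed simp
  ultimately show ?thesis by simp
qed

text \<open>The bound \<open>sqrt (1 + u) \<le> 1 + u/2\<close> splits each weight into terms of
  degrees \<open>2m\<close> and \<open>2m + 2\<close>. Regrouped by degree, they are compared with
  the coefficients of \<open>exp (x\<^sup>2)\<close>.\<close>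

lemma taylor_weight_sum:
  fixes x :: real
  obtains s where
    "((\<lambda>m. x ^ (2 * m) / fact (2 * m) * sqrt (1 + (x / (2 * real m + 1))\<^sup>2)) has_sum s) UNIV"
    "s \<le> exp (x\<^sup>2)"
proof -
  define f where "f m = x ^ (2 * m) / fact (2 * m) * sqrt (1 + (x / (2 * real m + 1))\<^sup>2)" for m
  define a where "a m = x ^ (2 * m) / fact (2 * m)" for m
  \<comment> \<open>The higher-degree part of weight \<open>m\<close> is stored at index
    \<open>m + 1\<close>; the value 0 at \<open>m = 0\<close> makes this shift harmless for the
    sum.\<close>
  define b where "b m = (if m = 0 then 0 else x ^ (2 * m) / (2 * fact (2 * m - 2) * (2 * real m - 1)\<^sup>2))" for m
  define e where "e m = inverse (fact m) * (x\<^sup>2) ^ m" for m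
  have xx: "x ^ (2 * m) = (x\<^sup>2) ^ m" for m
    by (rule power_mult)
  have nonneg: "a m \<ge> 0" "b m \<ge> 0" "f m \<ge> 0" for m
    by (auto simp: a_def b_def f_def xx)
  have f_le: "f m \<le> a m + b (Suc m)" for m
  proof -
    have "sqrt (1 + u) \<le> 1 + u / 2" if "u \<ge> 0" for u :: real
      using that by (intro real_le_lsqrt) (auto simp: power2_eq_square algebra_simps)
    then have "sqrt (1 + (x / (2 * real m + 1))\<^sup>2) \<le> 1 + (x / (2 * real m + 1))\<^sup>2 / 2"
      by simp
    then have "f m \<le> a m * (1 + (x / (2 * real m + 1))\<^sup>2 / 2)"
      unfolding f_def a_def by (rule mult_left_mono) (simp add: xx)
    also have "\<dots> = a m + b (Suc m)"
      by (simp add: a_def b_def power_divide power2_eq_square algebra_simps)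
    finally show ?thesis .
  qed
  have ab_le: "a m + b m \<le> e m" for m
  proof (cases "m = 0")
    case False
    then have "x ^ (2 * m) * (1 / fact (2 * m) + 1 / (2 * fact (2 * m - 2) * (2 * real m - 1)\<^sup>2)) \<le> x ^ (2 * m) * (1 / fact m)"
      by (intro mult_left_mono taylor_coefficient_le) (auto simp: xx)
    then show ?thesis
      using False by (simp add: a_def b_def e_def field_simps flip: xx)
  qed (simp add: a_def b_def e_def)
  have e: "e sums exp (x\<^sup>2)"
    unfolding e_def using exp_converges[of "x\<^sup>2"] by simp
  have "norm (a m) \<le> e m" "norm (b m) \<le> e m" for m
    using ab_le[of m] nonneg[of m] by auto
  then have "summable a" "summable b"
    using summable_comparison_test'[OF sums_summable[OF e], of 0] by blast+
  then have abs: "summable (\<lambda>m. a m + b (Suc m))"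
    by (intro summable_add) (simp_all add: summable_Suc_iff)
  then have f: "summable f"
    by (rule summable_comparison_test'[of _ 0]) (use nonneg f_le in simp)
  have "suminf f \<le> (\<Sum>m. a m + b (Suc m))"
    by (rule suminf_le[OF f_le f abs])
  also have "\<dots> = (\<Sum>m. a m) + (\<Sum>m. b (Suc m))"
    using \<open>summable a\<close> \<open>summable b\<close> by (intro suminf_add[symmetric]) (simp_all add: summable_Suc_iff)
  also have "(\<Sum>m. b (Suc m)) = (\<Sum>m. b m)"
  proof -
    have "b 0 = 0"
      by (simp add: b_def)
    then show ?thesis
      using suminf_split_head[OF \<open>summable b\<close>] by simp
  qed
  also have "(\<Sum>m. a m) + (\<Sum>m. b m) = (\<Sum>m. a m + b m)"
    using \<open>summable a\<close> \<open>summable b\<close> by (rule suminf_add)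
  also have "\<dots> \<le> suminf e"
    by (rule suminf_le[OF ab_le summable_add[OF \<open>summable a\<close> \<open>summable b\<close>] sums_summable[OF e]])
  also have "suminf e = exp (x\<^sup>2)"
    using e by (simp add: sums_iff)
  finally have "suminf f \<le> exp (x\<^sup>2)" .
  moreover have "(f has_sum suminf f) UNIV"
    by (rule sums_nonneg_imp_has_sum[OF summable_sums[OF f] nonneg(3)])
  ultimately show ?thesis
    using that unfolding f_def by blast
qed

lemma decomposable_affine_pauli:
  assumes "P \<in> pauli_ops"
  shows "decomposable 1 (sqrt (1 + y\<^sup>2)) (mat 1 + y *\<^sub>R cscale \<i> P)"
proof -
  have pos: "sqrt (1 + y\<^sup>2) > 0"
    by (simp add: add_pos_nonneg)
  \<comment> \<open>At angle \<open>arctan y\<close>, cosine and sine are \<open>1\<close> and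
    \<open>y\<close> divided by this scale, which cancels.\<close>
  have "decomposable 1 (sqrt (1 + y\<^sup>2) * 1) (sqrt (1 + y\<^sup>2) *\<^sub>R
      (cos (arctan y) *\<^sub>R mat 1 + sin (arctan y) *\<^sub>R cscale \<i> P))"
    using pos by (intro decomposable_scaleR decomposable_implementable implementable_pauli_rotation assms) auto
  then show ?thesis
    using pos by (simp add: cos_arctan sin_arctan scaleR_add_right)
qed

lemma mexp_sums_paired:
  fixes J :: "complex^'a::finite^'a"
  shows "(\<lambda>m. (x ^ (2 * m) / fact (2 * m)) *\<^sub>R
    (mpow (J ** J) m ** (mat 1 + (x / (2 * real m + 1)) *\<^sub>R J))) sums mexp (x *\<^sub>R J)"
proof -
  have pow: "mpow (x *\<^sub>R J) k = x ^ k *\<^sub>R mpow J k" for k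
    by (simp add: mpow_cscale flip: cscale_of_real of_real_power)
  have even: "mpow J (2 * m) = mpow (J ** J) m" for m
    by (induction m) (simp_all add: mpow_Suc matrix_mul_assoc)
  have odd: "mpow J (Suc (2 * m)) = mpow (J ** J) m ** J" for m
    using mpow_add[of J "2 * m" 1] by (simp add: mpow_Suc even)
  \<comment> \<open>A block of two consecutive terms; the factor \<open>1 / (2m + 1)\<close> is the
    quotient of their factorials.\<close>
  have "(\<Sum>k = m * 2..<m * 2 + 2. mpow (x *\<^sub>R J) k /\<^sub>R fact k) = (x ^ (2 * m) / fact (2 * m)) *\<^sub>R
    (mpow (J ** J) m ** (mat 1 + (x / (2 * real m + 1)) *\<^sub>R J))" for m
  proof -
    have "{m * 2..<m * 2 + 2} = {2 * m, Suc (2 * m)}"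
      by auto
    then show ?thesis
      by (simp add: pow even[unfolded mult.commute[of 2]] odd[unfolded mult.commute[of 2]] matrix_bilinear scaleR_add_right divide_inverse mult_ac add_ac)
  qed
  then show ?thesis
    using sums_group[OF mexp_sums[of "x *\<^sub>R J"], of 2] by simp
qed

lemma decomposable_mexp_step:
  fixes P :: "'l \<Rightarrow> 'n::finite qop" and x :: real
  assumes L: "finite L" "\<And>l. l \<in> L \<Longrightarrow> p l > 0" "(\<Sum>l\<in>L. p l) = 1"
    and P: "\<And>l. l \<in> L \<Longrightarrow> P l \<in> pauli_ops"
  obtains s where "decomposable 1 s (mexp (x *\<^sub>R cscale \<i> (\<Sum>l\<in>L. p l *\<^sub>R P l)))"
    "s \<le> exp (x\<^sup>2)"
proof -
  define J where "J = cscale \<i> (\<Sum>l\<in>L. p l *\<^sub>R P l)"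
  have J: "J = (\<Sum>l\<in>L. p l *\<^sub>R cscale \<i> (P l))"
    by (simp add: J_def cscale_sum cscale_scaleR)
  \<comment> \<open>The sign from \<open>\<i>\<close> squared goes to one factor, leaving two convex
    combinations of Pauli operators of weight 1 each.\<close>
  have JJ: "J ** J = (\<Sum>l\<in>L. p l *\<^sub>R (- P l)) ** (\<Sum>l\<in>L. p l *\<^sub>R P l)"
    by (simp add: J_def cscale_mult_left cscale_mult_right matrix_bilinear sum_negf)
  have "decomposable 0 1 (\<Sum>l\<in>L. p l *\<^sub>R Q l)" if "\<And>l. l \<in> L \<Longrightarrow> Q l \<in> pauli_ops"
    for Q :: "'l \<Rightarrow> 'n qop"
    by (rule decomposable_convex[OF L]) (simp_all add: decomposable_implementable implementable_pauli that)
  then have "decomposable (0 + 0) (1 * 1) (J ** J)"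
    unfolding JJ by (intro decomposable_mult) (simp_all add: pauli_ops_minus P del: scaleR_minus_right)
  then have JJm: "decomposable 0 1 (mpow (J ** J) m)" for m
    using decomposable_mpow[of 0 1 "J ** J" m] by simp
  have affine: "decomposable 1 (sqrt (1 + y\<^sup>2)) (mat 1 + y *\<^sub>R J)" for y
  proof -
    \<comment> \<open>As the \<open>p l\<close> sum to 1, the identity can be spread over the
      terms.\<close>
    have "mat 1 + y *\<^sub>R J = (\<Sum>l\<in>L. p l *\<^sub>R (mat 1 + y *\<^sub>R cscale \<i> (P l)))"
      using L(3) by (simp add: J scaleR_add_right sum.distrib scaleR_sum_right mult.commute
        flip: scaleR_sum_left)
    moreover have "decomposable 1 (sqrt (1 + y\<^sup>2)) \<dots>"
      by (intro decomposable_convex L decomposable_affine_pauli P)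
    ultimately show ?thesis
      by simp
  qed
  define E where "E m = (x ^ (2 * m) / fact (2 * m)) *\<^sub>R
    (mpow (J ** J) m ** (mat 1 + (x / (2 * real m + 1)) *\<^sub>R J))" for m
  define w where "w m = x ^ (2 * m) / fact (2 * m) * sqrt (1 + (x / (2 * real m + 1))\<^sup>2)" for m
  \<comment> \<open>The scalar is nonnegative whatever the sign of \<open>x\<close>, since the power
    is even.\<close>
  have E: "decomposable 1 (w m) (E m)" for m
    using decomposable_scaleR[OF decomposable_mult[OF JJm affine], of "x ^ (2 * m) / fact (2 * m)"]
    by (simp add: E_def w_def power_mult)
  obtain s where s: "(w has_sum s) UNIV" "s \<le> exp (x\<^sup>2)"
    unfolding w_def by (rule taylor_weight_sum)
  have "summable (\<lambda>m. w m * sqrt CARD('n \<Rightarrow> bool))"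
    by (intro summable_mult2 sums_summable[OF has_sum_imp_sums[OF s(1)]])
  then have "summable (\<lambda>m. norm (E m))"
    by (rule summable_comparison_test'[of _ 0]) (use decomposable_norm_le[OF E] in simp)
  then have E_sum: "(E has_sum mexp (x *\<^sub>R J)) UNIV"
    using mexp_sums_paired[of x J] unfolding E_def by (rule norm_summable_imp_has_sum)
  have "decomposable 1 s (mexp (x *\<^sub>R J))"
    by (rule decomposable_has_sum[OF _ E s(1) E_sum]) simp
  then show ?thesis
    using that s(2) unfolding J_def by blast
qed

theorem lemma2:
  fixes L :: "'l set" and p :: "'l \<Rightarrow> real" and P :: "'l \<Rightarrow> 'n::finite qop"
    and H :: "'n qop" and t :: real and r :: nat
  assumes "finite L"
    and "\<And>l. l \<in> L \<Longrightarrow> P l \<in> pauli_ops"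
    and "\<And>l. l \<in> L \<Longrightarrow> p l > 0"
    and "(\<Sum>l\<in>L. p l) = 1"
    and "H = (\<Sum>l\<in>L. p l *\<^sub>R P l)"
    and "hermitian H"
    and "r \<ge> 1"
  shows "\<exists>(S :: nat set) (b :: nat \<Rightarrow> real) (U :: nat \<Rightarrow> 'n qop).
    (\<forall>k\<in>S. b k > 0 \<and> unitary (U k)) \<and>
    (\<lambda>k. op_norm (b k *\<^sub>R U k)) summable_on S \<and>
    ((\<lambda>k. b k *\<^sub>R U k) has_sum mexp (cscale (\<i> * of_real t) H)) S \<and>
    b summable_on S \<and> (\<Sum>\<^sub>\<infinity>k\<in>S. b k) \<le> exp (t\<^sup>2 / real r) \<and>
    (\<forall>k\<in>S. circuit r (controlled (U k)))"
proof -
  define x where "x = t / real r"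
  obtain s where dec: "decomposable 1 s (mexp (x *\<^sub>R cscale \<i> H))" and s_le: "s \<le> exp (x\<^sup>2)"
    unfolding assms(5) by (rule decomposable_mexp_step[of L p P x]) (use assms in simp_all)
  have x: "x *\<^sub>R cscale \<i> H = cscale (\<i> * of_real x) H"
    by (simp add: mult.commute flip: cscale_of_real)
  have "mpow (mexp (x *\<^sub>R cscale \<i> H)) r = mexp (cscale (\<i> * of_real t) H)"
    unfolding x mpow_mexp using assms(7) by (simp add: x_def mult_ac)
  then have "decomposable r (s ^ r) (mexp (cscale (\<i> * of_real t) H))"
    using decomposable_mpow[OF dec, of r] by simp
  then obtain S :: "nat set" and b U where S: "\<And>k. k \<in> S \<Longrightarrow> b k > 0 \<and> implementable r (U k)"
    and b: "(b has_sum s ^ r) S" and U: "((\<lambda>k. b k *\<^sub>R U k) has_sum mexp (cscale (\<i> * of_real t) H)) S"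
    unfolding decomposable_def by blast
  \<comment> \<open>Monotonicity of the power relies on \<open>s\<close> being nonnegative, as a sum
    of positive weights.\<close>
  have "s ^ r \<le> exp (x\<^sup>2) ^ r"
    using decomposable_nonneg[OF dec] s_le by (intro power_mono)
  also have "\<dots> = exp (t\<^sup>2 / real r)"
    using assms(7) by (simp add: x_def power2_eq_square flip: exp_of_nat_mult)
  finally have "(\<Sum>\<^sub>\<infinity>k\<in>S. b k) \<le> exp (t\<^sup>2 / real r)"
    using infsumI[OF b] by simp
  moreover have "(\<lambda>k. op_norm (b k *\<^sub>R U k)) summable_on S"
  proof -
    obtain K where K: "\<And>A :: 'n qop. 0 \<le> op_norm A \<and> op_norm A \<le> K * norm A"
      using op_norm_bound by metis
    define c where "c = K * sqrt CARD('n \<Rightarrow> bool)"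
    \<comment> \<open>Equal norms of the \<open>U k\<close> reduce this to a constant times
      \<open>b k\<close>; the outer norm on the right avoids fixing the sign of
      \<open>K\<close>.\<close>
    have "norm (op_norm (b k *\<^sub>R U k)) \<le> norm (c * b k)" if "k \<in> S" for k
      using K[of "b k *\<^sub>R U k"] S[OF that] norm_unitary[of "U k"]
      by (simp add: implementable_def c_def mult_ac)
    moreover have "(\<lambda>k. norm (c * b k)) summable_on S"
    proof -
      have "norm (c * b k) = \<bar>c\<bar> * b k" if "k \<in> S" for k
        using S[OF that] by (simp add: abs_mult)
      then show ?thesis
        by (subst summable_on_cong, assumption) (rule has_sum_imp_summable[OF has_sum_cmult_right[OF b]])
    qed
    ultimately show ?thesis
      by (rule abs_summable_summable[OF Infinite_Sum.abs_summable_on_comparison_test, rotated])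
  qed
  ultimately show ?thesis
    using S b U unfolding implementable_def summable_on_def by blast
qed

end
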